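(* Let $a\ge 1$ and $n\ge 1$ be integers. The correspondence assigning to each pair $(\pi,\Lambda)$, where $\pi$ is a permutation of $\{1,\ldots,n\}$ and $\Lambda$ is an $a$-Catalan path with $n$ up steps, the weighted digraph encoded by $(\pi,\Lambda)$, is a bijection between the set of all such pairs and the set of valid $m$-acyclic weighted digraphs associated to the $a$-Catalan arrangement $\mathcal{A}^{a,a}_{n-1}$.
   Context: The $a$-Catalan arrangement $\mathcal{A}^{a,a}_{n-1}$ consists of the hyperplanes $x_i-x_j=1-a,2-a,\ldots,a-1$, $1\le i<j\le n$, in $V_{n-1}=\{x\in\mathbb{R}^n: x_1+\cdots+x_n=0\}$. A valid weighted digraph associated to it has vertex set $\{1,\ldots,n\}$ and for each $i<j$ exactly one of the following holds: there is only an edge $j\rightarrow i$, of weight $a-1$; there is an edge $i\rightarrow j$ of weight $w$ and an edge $j\rightarrow i$ of weight $-w-1$ for some integer $1-a\le w\le a-2$; there is only an edge $i\rightarrow j$, of weight $a-1$. It is $m$-acyclic if it contains no directed cycle of nonnegative total weight. Write $w(i,j)$ for the weight of $i\rightarrow j$, and $w(i,j)=-\infty$ if there is no such edge. An $a$-Catalan path with $n$ up steps is a lattice path with $n$ up steps $(1,a-1)$ and $(a-1)n$ down steps $(1,-1)$ from $(0,0)$ to $(an,0)$ that stays weakly above the horizontal axis. The weighted digraph encoded by $(\pi,\Lambda)$: label the $i$th up step of $\Lambda$ from the left with $\pi(i)$ and let $\ell(\pi(i))$ be the height (second coordinate) of the lower end of this up step. For $i<j$ put $$w(\pi(i),\pi(j))=\begin{cases}\ell(\pi(j))-\ell(\pi(i)),&\text{if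 }1-a\le\ell(\pi(j))-\ell(\pi(i))\le a-1;\\ -\infty,&\text{if }\ell(\pi(j))-\ell(\pi(i))<1-a;\\ a-1,&\text{if }\ell(\pi(j))-\ell(\pi(i))>a-1,\end{cases}$$ and define the weight for the reversed ordered pair by $w(u,v)=-1-w(v,u)$ if $w(v,u)\in[1-a,a-2]$; $w(u,v)=-\infty$ if $w(v,u)=a-1$; $w(u,v)=a-1$ if $w(v,u)=-\infty$. (This is always a valid $m$-acyclic weighted digraph.) *)

theory Defs
  imports "HOL-Combinatorics.Permutations" "HOL-Library.Product_Plus"
begin

text \<open>
  A weighted digraph on vertices of type \<^typ>\<open>nat\<close> without parallel edges is given by its weight
  function: \<open>w u v = Some x\<close> means that there is an edge \<open>u \<rightarrow> v\<close> of weight \<open>x\<close>, and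
  \<open>w u v = None\<close> (weight minus infinity) that there is no such edge.
\<close>

type_synonym wdigraph = "nat \<Rightarrow> nat \<Rightarrow> int option"

text \<open>
  The three alternatives for a pair \<open>i < j\<close> are mutually exclusive, since they differ in which of
  the two edges are present. The first conjunct says that the vertex set is \<open>{1..n}\<close> and that
  there are no loops, so that distinct weight functions are distinct digraphs.
\<close>

definition valid_wdigraph :: "nat \<Rightarrow> nat \<Rightarrow> wdigraph \<Rightarrow> bool" where
  "valid_wdigraph a n w \<longleftrightarrow>
     (\<forall>u v. w u v \<noteq> None \<longrightarrow> u \<in> {1..n} \<and> v \<in> {1..n} \<and> u \<noteq> v) \<and>
     (\<forall>i\<in>{1..n}. \<forall>j\<in>{1..n}. i < j \<longrightarrow>
        (w i j = None \<and> w j i = Some (int a - 1)) \<or>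
        (\<exists>x. 1 - int a \<le> x \<and> x \<le> int a - 2 \<and> w i j = Some x \<and> w j i = Some (- x - 1)) \<or>
        (w i j = Some (int a - 1) \<and> w j i = None))"

text \<open>
  A directed cycle is the list \<open>vs\<close> of its vertices, in order; the last vertex is followed
  by the first.
\<close>

definition cycle_next :: "nat list \<Rightarrow> nat \<Rightarrow> nat" where
  "cycle_next vs k = vs ! (Suc k mod length vs)"

definition directed_cycle :: "wdigraph \<Rightarrow> nat list \<Rightarrow> bool" where
  "directed_cycle w vs \<longleftrightarrow>
     vs \<noteq> [] \<and> distinct vs \<and> (\<forall>k<length vs. w (vs ! k) (cycle_next vs k) \<noteq> None)"

definition cycle_weight :: "wdigraph \<Rightarrow> nat list \<Rightarrow> int" where
  "cycle_weight w vs = (\<Sum>k<length vs. the (w (vs ! k) (cycle_next vs k)))"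

definition m_acyclic :: "wdigraph \<Rightarrow> bool" where
  "m_acyclic w \<longleftrightarrow> \<not> (\<exists>vs. directed_cycle w vs \<and> cycle_weight w vs \<ge> 0)"

datatype step = Up | Down

fun step_vec :: "nat \<Rightarrow> step \<Rightarrow> int \<times> int" where
  "step_vec a Up = (1, int a - 1)"
| "step_vec a Down = (1, - 1)"

definition path_point :: "nat \<Rightarrow> step list \<Rightarrow> nat \<Rightarrow> int \<times> int" where
  "path_point a p k = sum_list (map (step_vec a) (take k p))"

text \<open>
  As steps are straight, a path stays weakly above the axis iff its lattice points do.
\<close>

definition catalan_path :: "nat \<Rightarrow> nat \<Rightarrow> step list \<Rightarrow> bool" where
  "catalan_path a n p \<longleftrightarrow>
     count_list p Up = n \<and> count_list p Down = (a - 1) * n \<and>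
     path_point a p (length p) = (int a * int n, 0) \<and>
     (\<forall>k\<le>length p. 0 \<le> snd (path_point a p k))"

text \<open>Height of the lower end of the \<open>i\<close>th up step from the left, counting from \<open>i = 1\<close>.\<close>

definition up_step_height :: "nat \<Rightarrow> step list \<Rightarrow> nat \<Rightarrow> int" where
  "up_step_height a p i =
     snd (path_point a p (filter (\<lambda>k. p ! k = Up) [0..<length p] ! (i - 1)))"

definition label_height :: "nat \<Rightarrow> (nat \<Rightarrow> nat) \<Rightarrow> step list \<Rightarrow> nat \<Rightarrow> int" where
  "label_height a \<pi> p v = up_step_height a p (inv \<pi> v)"

definition forward_weight :: "nat \<Rightarrow> int \<Rightarrow> int option" where
  "forward_weight a d =
     (if d < 1 - int a then None
      else if d > int a - 1 then Some (int a - 1)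
      else Some d)"

text \<open>
  The weight of \<open>u \<rightarrow> v\<close> in terms of that of \<open>v \<rightarrow> u\<close>. Weights never exceed \<open>a - 1\<close>, so the
  \<open>else\<close> branch is the case of weight exactly \<open>a - 1\<close>.
\<close>

fun reverse_weight :: "nat \<Rightarrow> int option \<Rightarrow> int option" where
  "reverse_weight a None = Some (int a - 1)"
| "reverse_weight a (Some x) =
     (if 1 - int a \<le> x \<and> x \<le> int a - 2 then Some (- 1 - x) else None)"

text \<open>For \<open>u = \<pi> i\<close> and \<open>v = \<pi> j\<close>, the indices are recovered as \<open>i = inv \<pi> u\<close> and \<open>j = inv \<pi> v\<close>.\<close>

definition encoded_wdigraph :: "nat \<Rightarrow> nat \<Rightarrow> (nat \<Rightarrow> nat) \<times> step list \<Rightarrow> wdigraph" where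
  "encoded_wdigraph a n = (\<lambda>(\<pi>, p) u v.
     let l = label_height a \<pi> p in
     if u \<notin> {1..n} \<or> v \<notin> {1..n} \<or> u = v then None
     else if inv \<pi> u < inv \<pi> v then forward_weight a (l v - l u)
     else reverse_weight a (forward_weight a (l u - l v)))"

end

theory Submission
  imports Defs
begin

text \<open>
  A path is determined by the heights \<open>h\<^sub>1, \<dots>, h\<^sub>n\<close> of its up steps, and the sequences that
  occur are the nonnegative ones with \<open>h\<^sub>1 = 0\<close> and \<open>h\<^sub>k\<^sub>+\<^sub>1 \<le> h\<^sub>k + a - 1\<close>. Thus a pair
  \<open>(\<pi>, \<Lambda>)\<close> is a listing of the vertices together with a height function \<open>h\<close> on them. Write \<open>w\<close>
  for the encoded digraph. For any two vertices, in either order, the weight of \<open>u \<rightarrow> v\<close> is the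
  truncation (\<open>forward_weight\<close>) of \<open>h v - h u - b\<close>, where \<open>b = 1\<close> if \<open>v\<close> is listed before \<open>u\<close> and
  \<open>b = 0\<close> otherwise (\<open>encoded_wdigraph_eq\<close>). Truncation never increases a weight, so around a cycle
  the heights cancel and the weight is at most minus the number of backward edges, of which there
  is at least one. This is why encoded digraphs are acyclic.

  Call an edge \<open>u \<rightarrow> v\<close> tight if its weight equals \<open>h v - h u\<close>. Tight edges go forward in the
  listing. Since heights climb by at most \<open>a - 1\<close> per step, every vertex of positive height has a
  tight edge coming in from a lower vertex. Hence \<open>h v\<close> is the greatest weight of a walk ending
  in \<open>v\<close>, and \<open>w\<close> determines \<open>h\<close> (\<open>encoded_height_le\<close>). The listing is determined as well: at
  each stage the next vertex must be the highest one among those that have no tight edge from a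
  remaining vertex. If a lower one came next, then the climb to the highest one later on would
  pass through a vertex with a tight edge to it (\<open>encoded_perm_step\<close>).

  Conversely, from a valid digraph without cycles of nonnegative weight, define \<open>h\<close> by maximal
  path weights (\<open>potential_exists\<close>) and list the vertices by this greedy rule
  (\<open>greedy_listing\<close>). A newly available vertex has a tight edge from the vertex just listed, and
  so is at most \<open>a - 1\<close> higher. Vertices that were available before are not higher at all.
  Hence the heights along the listing belong to a path, and the trichotomy in the definition of a
  valid digraph leaves only the encoded weights for each pair (\<open>valid_weights_from_heights\<close>).
\<close>

section \<open>Paths and the heights of their up steps\<close>

fun up_heights :: "nat \<Rightarrow> int \<Rightarrow> step list \<Rightarrow> int list" where
  "up_heights a c [] = []"
| "up_heights a c (Up # p) = c # up_heights a (c + (int a - 1)) p"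
| "up_heights a c (Down # p) = up_heights a (c - 1) p"

text \<open>
  The parameter \<open>c\<close> is the height at which the path \<open>p\<close> starts: suffixes of Catalan paths are
  needed for structural induction.
\<close>

fun ends_on_axis :: "nat \<Rightarrow> int \<Rightarrow> step list \<Rightarrow> bool" where
  "ends_on_axis a c [] \<longleftrightarrow> c = 0"
| "ends_on_axis a c (s # p) \<longleftrightarrow> 0 \<le> c \<and> ends_on_axis a (c + snd (step_vec a s)) p"

text \<open>
  The bound \<open>c\<close> is the height after the previous up step, from which the path can only descend
  before the next one. With \<open>c = 0\<close> the first height is forced to be \<open>0\<close>.
\<close>

fun admissible :: "nat \<Rightarrow> int \<Rightarrow> int list \<Rightarrow> bool" where
  "admissible a c [] \<longleftrightarrow> True"
| "admissible a c (h # hs) \<longleftrightarrow> 0 \<le> h \<and> h \<le> c \<and> admissible a (h + (int a - 1)) hs"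

lemma path_point_0: "path_point a p 0 = 0"
  by (simp add: path_point_def)

lemma path_point_Cons_Suc: "path_point a (s # p) (Suc k) = step_vec a s + path_point a p k"
  by (simp add: path_point_def)

lemma path_point_length:
  "path_point a p (length p) =
     (int (count_list p Up + count_list p Down),
      (int a - 1) * int (count_list p Up) - int (count_list p Down))"
proof (induction p)
  case Nil
  then show ?case by (simp add: path_point_0 zero_prod_def)
next
  case (Cons s p)
  then show ?case by (cases s) (simp_all add: path_point_Cons_Suc algebra_simps)
qed

lemma ends_on_axis_iff:
  "ends_on_axis a c p \<longleftrightarrow>
     c + snd (path_point a p (length p)) = 0 \<and> (\<forall>k\<le>length p. 0 \<le> c + snd (path_point a p k))"
proof (induction p arbitrary: c)
  case Nil
  then show ?case by (auto simp: path_point_0)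
next
  case (Cons s p)
  have "(\<forall>k\<le>length (s # p). 0 \<le> c + snd (path_point a (s # p) k)) \<longleftrightarrow>
      0 \<le> c \<and> (\<forall>k\<le>length p. 0 \<le> c + snd (step_vec a s) + snd (path_point a p k))"
    by (simp add: All_less_Suc2 less_Suc_eq_le[symmetric] path_point_0 path_point_Cons_Suc
        add.assoc del: step_vec.simps)
  then show ?case
    using Cons[of "c + snd (step_vec a s)"] by (auto simp: path_point_Cons_Suc add.assoc)
qed

lemma catalan_path_iff:
  assumes "a \<ge> 1"
  shows "catalan_path a n p \<longleftrightarrow> count_list p Up = n \<and> ends_on_axis a 0 p"
proof -
  have "int ((a - 1) * m) = (int a - 1) * int m" for m
    using assms by (simp add: of_nat_diff)
  then have "count_list p Down = (a - 1) * n \<longleftrightarrow> int (count_list p Down) = (int a - 1) * int n"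
    by (metis of_nat_eq_iff)
  then show ?thesis
    unfolding catalan_path_def ends_on_axis_iff path_point_length
    by (auto simp: algebra_simps)
qed

lemma length_up_heights: "length (up_heights a c p) = count_list p Up"
  by (induction a c p rule: up_heights.induct) auto

lemma up_heights_eq_map:
  "up_heights a c p =
     map (\<lambda>k. c + snd (path_point a p k)) (filter (\<lambda>k. p ! k = Up) [0..<length p])"
proof (induction p arbitrary: c)
  case Nil
  then show ?case by simp
next
  case (Cons s p)
  have "[0..<length (s # p)] = 0 # map Suc [0..<length p]"
    by (simp add: map_Suc_upt upt_conv_Cons del: upt_Suc)
  then show ?case
    by (cases s) (simp_all add: Cons path_point_0 path_point_Cons_Suc filter_map o_def
        algebra_simps del: upt_Suc)
qed

lemma up_step_height_eq:
  assumes "i - 1 < count_list p Up"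
  shows "up_step_height a p i = up_heights a 0 p ! (i - 1)"
proof -
  have "i - 1 < length (up_heights a 0 p)"
    using assms by (simp add: length_up_heights)
  then show ?thesis
    by (simp add: up_step_height_def up_heights_eq_map)
qed

lemma admissible_mono: "admissible a c hs \<Longrightarrow> c \<le> d \<Longrightarrow> admissible a d hs"
  by (cases hs) auto

lemma admissible_up_heights: "ends_on_axis a c p \<Longrightarrow> admissible a c (up_heights a c p)"
  by (induction a c p rule: up_heights.induct) (auto intro: admissible_mono)

lemma ends_on_axis_nonneg: "ends_on_axis a c p \<Longrightarrow> 0 \<le> c"
  by (cases p) auto

text \<open>
  Between two up steps the number of down steps is the drop in height, and after the last one it is
  the drop to the axis. In the proof, two paths that differ in their next step cannot agree in
  their up heights: one has an up step at height \<open>c\<close>, and the next up step of the other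
  starts below \<open>c\<close>.
\<close>

lemma up_heights_inject:
  assumes "ends_on_axis a c p" "ends_on_axis a c q" "up_heights a c p = up_heights a c q"
  shows "p = q"
  using assms
proof (induction p arbitrary: c q)
  case Nil
  show ?case
  proof (cases q)
    case (Cons s q')
    with Nil show ?thesis
      using ends_on_axis_nonneg[of a "-1" q'] by (cases s) auto
  qed simp
next
  case (Cons s p)
  have first: "h \<le> d" if "ends_on_axis a d r" "up_heights a d r = h # hs" for d r h hs
    using admissible_up_heights[OF that(1)] that(2) by simp
  show ?case
  proof (cases q)
    case Nil
    with Cons.prems show ?thesis
      using ends_on_axis_nonneg[of a "-1" p] by (cases s) auto
  next
    case (Cons t q')
    show ?thesis
    proof (cases s; cases t)
      assume "s = Up" "t = Up"
      then show ?thesis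
        using Cons Cons.IH[of "c + (int a - 1)" q'] Cons.prems by simp
    next
      assume "s = Down" "t = Down"
      then show ?thesis
        using Cons Cons.IH[of "c - 1" q'] Cons.prems by simp
    next
      assume "s = Up" "t = Down"
      then show ?thesis
        using Cons Cons.prems first[of "c - 1" q' c "up_heights a (c + (int a - 1)) p"] by simp
    next
      assume "s = Down" "t = Up"
      then show ?thesis
        using Cons Cons.prems first[of "c - 1" p c "up_heights a (c + (int a - 1)) q'"] by simp
    qed
  qed
qed

lemma descend:
  assumes "int m \<le> c"
  shows "ends_on_axis a c (replicate m Down @ p) \<longleftrightarrow> ends_on_axis a (c - int m) p"
    and "up_heights a c (replicate m Down @ p) = up_heights a (c - int m) p"
  using assms by (induction m arbitrary: c) (auto simp: algebra_simps)

lemma path_with_up_heights: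
  assumes "a \<ge> 1" "0 \<le> c" "admissible a c hs"
  shows "\<exists>p. ends_on_axis a c p \<and> up_heights a c p = hs"
  using assms(2,3)
proof (induction hs arbitrary: c)
  case Nil
  then show ?case
    using descend[of "nat c" c a "[]"] by (intro exI[of _ "replicate (nat c) Down"]) simp
next
  case (Cons h hs)
  obtain p where p: "ends_on_axis a (h + (int a - 1)) p" "up_heights a (h + (int a - 1)) p = hs"
    using Cons.IH[of "h + (int a - 1)"] Cons.prems assms(1) by auto
  then show ?case
    using Cons.prems descend[of "nat (c - h)" c a "Up # p"]
    by (intro exI[of _ "replicate (nat (c - h)) Down @ Up # p"]) simp
qed

lemma admissible_nth:
  assumes "admissible a c hs"
  shows "k < length hs \<Longrightarrow> 0 \<le> hs ! k"
    and "0 < length hs \<Longrightarrow> hs ! 0 \<le> c"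
    and "Suc k < length hs \<Longrightarrow> hs ! Suc k \<le> hs ! k + (int a - 1)"
  using assms
proof (induction a c hs arbitrary: k rule: admissible.induct)
  case (2 a c h hs)
  {
    case 1
    then show ?case using 2(1) by (cases k) auto
  next
    case 2
    then show ?case by auto
  next
    case 3
    then show ?case using 2(2,3) by (cases k) auto
  }
qed auto

lemma up_step_height_facts:
  assumes "a \<ge> 1" "catalan_path a n p"
  shows "i \<in> {1..n} \<Longrightarrow> 0 \<le> up_step_height a p i"
    and "1 \<le> n \<Longrightarrow> up_step_height a p 1 = 0"
    and "1 \<le> i \<Longrightarrow> Suc i \<le> n \<Longrightarrow> up_step_height a p (Suc i) \<le> up_step_height a p i + (int a - 1)"
proof -
  let ?hs = "up_heights a 0 p"
  have p: "count_list p Up = n" "ends_on_axis a 0 p"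
    using assms by (auto simp: catalan_path_iff)
  have len: "length ?hs = n" and adm: "admissible a 0 ?hs"
    using p by (simp_all add: length_up_heights admissible_up_heights)
  show "0 \<le> up_step_height a p i" if "i \<in> {1..n}"
    using admissible_nth(1)[OF adm, of "i - 1"] that len p
    by (auto simp: up_step_height_eq)
  show "up_step_height a p 1 = 0" if "1 \<le> n"
    using admissible_nth(1)[OF adm, of 0] admissible_nth(2)[OF adm] that len p
    by (auto simp: up_step_height_eq)
  show "up_step_height a p (Suc i) \<le> up_step_height a p i + (int a - 1)"
    if "1 \<le> i" "Suc i \<le> n"
    using admissible_nth(3)[OF adm, of "i - 1"] that len p
    by (auto simp: up_step_height_eq)
qed

section \<open>The encoded digraph\<close>

text \<open>
  The reversal rule is absorbed by the shift by \<open>1\<close>: on untruncated weights it is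
  \<open>d \<mapsto> - d - 1\<close>, and this map carries the values truncated to \<open>a - 1\<close>, together with \<open>a - 1\<close>
  itself, to the values truncated to \<open>None\<close>.
\<close>

lemma encoded_wdigraph_eq:
  assumes "a \<ge> 1" "\<pi> permutes {1..n}" "u \<in> {1..n}" "v \<in> {1..n}" "u \<noteq> v"
  shows "encoded_wdigraph a n (\<pi>, p) u v =
    forward_weight a (label_height a \<pi> p v - label_height a \<pi> p u - of_bool (inv \<pi> v < inv \<pi> u))"
proof -
  have "inv \<pi> u \<noteq> inv \<pi> v"
    using assms by (metis permutes_inverses(1))
  then show ?thesis
    using assms by (auto simp: encoded_wdigraph_def Let_def forward_weight_def)
qed

lemma forward_weight_le: "forward_weight a d = Some x \<Longrightarrow> x \<le> d"
  by (auto simp: forward_weight_def split: if_splits)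

lemma encoded_edge_vertices:
  assumes "encoded_wdigraph a n (\<pi>, p) u v = Some x"
  shows "u \<in> {1..n}" "v \<in> {1..n}" "u \<noteq> v"
  using assms by (auto simp: encoded_wdigraph_def Let_def split: if_splits)

lemma encoded_edge_le:
  assumes "a \<ge> 1" "\<pi> permutes {1..n}" "encoded_wdigraph a n (\<pi>, p) u v = Some x"
  shows "x \<le> label_height a \<pi> p v - label_height a \<pi> p u - of_bool (inv \<pi> v < inv \<pi> u)"
  using assms(3) encoded_wdigraph_eq[OF assms(1,2) encoded_edge_vertices[OF assms(3)], of p]
  by (metis forward_weight_le)

lemma valid_encoded_wdigraph:
  assumes "a \<ge> 1" "\<pi> permutes {1..n}"
  shows "valid_wdigraph a n (encoded_wdigraph a n (\<pi>, p))"
proof -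
  have inv_neq: "inv \<pi> u \<noteq> inv \<pi> v" if "u \<noteq> v" for u v
    using assms that by (metis permutes_inverses(1))
  have dichotomy: "of_bool (inv \<pi> u < inv \<pi> v) = 1 - (of_bool (inv \<pi> v < inv \<pi> u) :: int)"
    if "u < v" for u v
    using inv_neq[of u v] that by (cases "inv \<pi> u < inv \<pi> v") auto
  show ?thesis
    unfolding valid_wdigraph_def
  proof (intro conjI ballI impI allI)
    fix u v
    assume "encoded_wdigraph a n (\<pi>, p) u v \<noteq> None"
    then show "u \<in> {1..n}" "v \<in> {1..n}" "u \<noteq> v"
      by (auto simp: encoded_wdigraph_def Let_def split: if_splits)
  next
    fix i j
    assume ij: "i \<in> {1..n}" "j \<in> {1..n}" "i < j"
    define d where "d = label_height a \<pi> p j - label_height a \<pi> p i - of_bool (inv \<pi> j < inv \<pi> i)"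
    have "encoded_wdigraph a n (\<pi>, p) i j = forward_weight a d"
      "encoded_wdigraph a n (\<pi>, p) j i = forward_weight a (- d - 1)"
      using ij assms dichotomy[of i j] by (simp_all add: encoded_wdigraph_eq d_def)
    then show "(encoded_wdigraph a n (\<pi>, p) i j = None \<and>
         encoded_wdigraph a n (\<pi>, p) j i = Some (int a - 1)) \<or>
        (\<exists>x. 1 - int a \<le> x \<and> x \<le> int a - 2 \<and> encoded_wdigraph a n (\<pi>, p) i j = Some x \<and>
         encoded_wdigraph a n (\<pi>, p) j i = Some (- x - 1)) \<or>
        (encoded_wdigraph a n (\<pi>, p) i j = Some (int a - 1) \<and>
         encoded_wdigraph a n (\<pi>, p) j i = None)"
      using assms(1) by (auto simp: forward_weight_def)
  qed
qed

lemma sum_cycle_next: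
  assumes "vs \<noteq> []"
  shows "(\<Sum>k<length vs. f (cycle_next vs k)) = (\<Sum>k<length vs. f (vs ! k))"
proof -
  obtain m where m: "length vs = Suc m"
    using assms by (cases vs) auto
  have "(\<Sum>k<length vs. f (cycle_next vs k)) = (\<Sum>k<m. f (vs ! Suc k)) + f (vs ! 0)"
    by (simp add: m cycle_next_def)
  also have "\<dots> = (\<Sum>k<length vs. f (vs ! k))"
    unfolding m by (subst sum.lessThan_Suc_shift) (simp add: add.commute)
  finally show ?thesis .
qed

text \<open>
  Summing the hypothesis around a cycle makes the potential differences cancel.
\<close>

lemma m_acyclic_if_potential:
  fixes \<phi> :: "nat \<Rightarrow> int"
  assumes "N > 0" and edge: "\<And>u v x. w u v = Some x \<Longrightarrow> N * x < \<phi> v - \<phi> u"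
  shows "m_acyclic w"
  unfolding m_acyclic_def
proof clarify
  fix vs
  assume cyc: "directed_cycle w vs" and "cycle_weight w vs \<ge> 0"
  have "vs \<noteq> []"
    using cyc by (simp add: directed_cycle_def)
  have "N * cycle_weight w vs = (\<Sum>k<length vs. N * the (w (vs ! k) (cycle_next vs k)))"
    by (simp add: cycle_weight_def sum_distrib_left)
  also have "\<dots> < (\<Sum>k<length vs. \<phi> (cycle_next vs k) - \<phi> (vs ! k))"
  proof (rule sum_strict_mono)
    show "{..<length vs} \<noteq> {}"
      using \<open>vs \<noteq> []\<close> by auto
  next
    fix k
    assume "k \<in> {..<length vs}"
    then show "N * the (w (vs ! k) (cycle_next vs k)) < \<phi> (cycle_next vs k) - \<phi> (vs ! k)"
      using cyc edge by (auto simp: directed_cycle_def)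
  qed simp
  also have "\<dots> = 0"
    using sum_cycle_next[OF \<open>vs \<noteq> []\<close>, of \<phi>] by (simp add: sum_subtractf)
  finally show False
    using \<open>N > 0\<close> \<open>cycle_weight w vs \<ge> 0\<close> by (simp add: mult_less_0_iff)
qed

lemma m_acyclic_encoded_wdigraph:
  assumes "a \<ge> 1" "\<pi> permutes {1..n}"
  shows "m_acyclic (encoded_wdigraph a n (\<pi>, p))"
proof (rule m_acyclic_if_potential)
  \<comment> \<open>The potential orders vertices by height and then by position: positions differ by less than
      \<open>n + 1\<close>, so one unit of weight outweighs any difference of positions.\<close>
  show "int n + 1 > 0"
    by simp
next
  fix u v x
  let ?l = "label_height a \<pi> p"
  assume x: "encoded_wdigraph a n (\<pi>, p) u v = Some x"
  note uv = encoded_edge_vertices[OF x]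
  have pos: "inv \<pi> u \<in> {1..n}" "inv \<pi> v \<in> {1..n}" "inv \<pi> u \<noteq> inv \<pi> v"
    using permutes_inv[OF assms(2)] uv by (auto simp: permutes_in_image simp del: atLeastAtMost_iff)
      (metis assms(2) permutes_inverses(1))
  have "x \<le> ?l v - ?l u - of_bool (inv \<pi> v < inv \<pi> u)"
    using encoded_edge_le[OF assms x] .
  then have "(int n + 1) * x \<le> (int n + 1) * (?l v - ?l u - of_bool (inv \<pi> v < inv \<pi> u))"
    by (intro mult_left_mono) auto
  also have "\<dots> < ((int n + 1) * ?l v + int (inv \<pi> v)) - ((int n + 1) * ?l u + int (inv \<pi> u))"
    using pos by (cases "inv \<pi> v < inv \<pi> u") (auto simp: algebra_simps)
  finally show "(int n + 1) * x <
     ((int n + 1) * ?l v + int (inv \<pi> v)) - ((int n + 1) * ?l u + int (inv \<pi> u))" .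
qed

section \<open>Injectivity: recovering the path and the permutation\<close>

text \<open>
  Discrete intermediate values: the last time before \<open>j\<close> at which \<open>f\<close> is below \<open>f j\<close> is followed
  by a value of at least \<open>f j\<close>, so the gap there is at most one climb \<open>b\<close>. In an encoded digraph
  this produces a tight edge into the vertex at position \<open>j\<close>.
\<close>

lemma crossing:
  fixes f :: "nat \<Rightarrow> int"
  assumes "i < j" "f i < f j" "\<And>k. i \<le> k \<Longrightarrow> k < j \<Longrightarrow> f (Suc k) \<le> f k + b"
  obtains t where "i \<le> t" "t < j" "f t < f j" "f j \<le> f t + b"
proof -
  define T where "T = {t. i \<le> t \<and> t < j \<and> f t < f j}"
  have T: "finite T" "T \<noteq> {}"
    using assms(1,2) by (auto simp: T_def)
  define t where "t = Max T"
  have t: "i \<le> t" "t < j" "f t < f j"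
    using Max_in[OF T] by (auto simp: t_def T_def)
  have "Suc t \<notin> T"
    using Max_ge[OF T(1), of "Suc t"] by (auto simp: t_def)
  then have "f j \<le> f (Suc t)"
    using t by (cases "Suc t = j") (auto simp: T_def)
  also have "\<dots> \<le> f t + b"
    using assms(3) t by simp
  finally show ?thesis
    using that t by blast
qed

lemma label_height_perm:
  assumes "\<pi> permutes S"
  shows "label_height a \<pi> p (\<pi> k) = up_step_height a p k"
  using assms by (simp add: label_height_def permutes_inverses)

lemma encoded_wdigraph_perm:
  assumes "a \<ge> 1" "\<pi> permutes {1..n}" "i \<in> {1..n}" "j \<in> {1..n}" "i \<noteq> j"
  shows "encoded_wdigraph a n (\<pi>, p) (\<pi> i) (\<pi> j) =
    forward_weight a (up_step_height a p j - up_step_height a p i - of_bool (j < i))"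
proof -
  have "\<pi> i \<in> {1..n}" "\<pi> j \<in> {1..n}" "\<pi> i \<noteq> \<pi> j"
    using assms permutes_in_image[OF assms(2)] by (auto simp: inj_eq[OF permutes_inj])
  then show ?thesis
    using assms by (simp add: encoded_wdigraph_eq label_height_perm permutes_inverses)
qed

text \<open>
  A chain of edges that are tight for \<open>(\<pi>, p)\<close> leads from a vertex of height \<open>0\<close> to any given
  vertex. No edge weight exceeds the height difference for \<open>(\<sigma>, q)\<close>, so along this chain the
  heights for \<open>(\<sigma>, q)\<close> climb at least as fast. By symmetry the two height functions agree.
\<close>

lemma encoded_height_le:
  assumes a: "a \<ge> 1" and \<pi>: "\<pi> permutes {1..n}" and p: "catalan_path a n p"
    and \<sigma>: "\<sigma> permutes {1..n}" and q: "catalan_path a n q"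
    and eq: "encoded_wdigraph a n (\<pi>, p) = encoded_wdigraph a n (\<sigma>, q)"
    and k: "k \<in> {1..n}"
  shows "up_step_height a p k \<le> label_height a \<sigma> q (\<pi> k)"
  using k
proof (induction k rule: less_induct)
  case (less k)
  let ?f = "up_step_height a p" and ?g = "label_height a \<sigma> q"
  have g_nonneg: "0 \<le> ?g (\<pi> k)"
    using less.prems permutes_in_image[OF \<pi>] permutes_in_image[OF permutes_inv[OF \<sigma>]]
    unfolding label_height_def by (intro up_step_height_facts(1)[OF a q]) simp
  show ?case
  proof (cases "?f k > 0")
    case False
    with g_nonneg show ?thesis by simp
  next
    case True
    have f1: "?f 1 = 0"
      using up_step_height_facts(2)[OF a p] less.prems by simp
    with True less.prems have "1 < k" "?f 1 < ?f k"
      by (auto intro: le_neq_trans)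
    moreover have "?f (Suc j) \<le> ?f j + (int a - 1)" if "1 \<le> j" "j < k" for j
      using up_step_height_facts(3)[OF a p] that less.prems by simp
    ultimately obtain t where t: "1 \<le> t" "t < k" "?f t < ?f k" "?f k \<le> ?f t + (int a - 1)"
      by (rule crossing)
    have "encoded_wdigraph a n (\<pi>, p) (\<pi> t) (\<pi> k) = Some (?f k - ?f t)"
      using t less.prems a \<pi> by (simp add: encoded_wdigraph_perm forward_weight_def)
    then have "?f k - ?f t \<le> ?g (\<pi> k) - ?g (\<pi> t) - of_bool (inv \<sigma> (\<pi> k) < inv \<sigma> (\<pi> t))"
      unfolding eq by (rule encoded_edge_le[OF a \<sigma>])
    then have "?f k - ?f t \<le> ?g (\<pi> k) - ?g (\<pi> t)"
      by (simp add: of_bool_def split: if_splits)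
    moreover have "?f t \<le> ?g (\<pi> t)"
      using less.IH[of t] t less.prems by simp
    ultimately show ?thesis by simp
  qed
qed

text \<open>
  If two listings first differ at position \<open>k\<close>, where \<open>\<pi> k\<close> is not higher than \<open>\<sigma> k\<close>, then \<open>\<pi>\<close>
  reaches \<open>\<sigma> k\<close> later on by a tight edge from some vertex \<open>\<pi> t\<close> with \<open>t \<ge> k\<close>. In the listing \<open>\<sigma>\<close>
  this edge goes backward, which is impossible for a tight edge.
\<close>

lemma encoded_perm_step:
  assumes a: "a \<ge> 1" and \<pi>: "\<pi> permutes {1..n}" and p: "catalan_path a n p"
    and \<sigma>: "\<sigma> permutes {1..n}"
    and eq: "encoded_wdigraph a n (\<pi>, p) = encoded_wdigraph a n (\<sigma>, q)"
    and heights: "\<And>v. v \<in> {1..n} \<Longrightarrow> label_height a \<pi> p v = label_height a \<sigma> q v"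
    and k: "k \<in> {1..n}" and agree: "\<And>j. j < k \<Longrightarrow> \<pi> j = \<sigma> j"
    and le: "label_height a \<pi> p (\<pi> k) \<le> label_height a \<pi> p (\<sigma> k)"
  shows "\<pi> k = \<sigma> k"
proof (rule ccontr)
  assume neq: "\<pi> k \<noteq> \<sigma> k"
  let ?f = "up_step_height a p"
  define j where "j = inv \<pi> (\<sigma> k)"
  have \<pi>j: "\<pi> j = \<sigma> k"
    by (simp add: j_def permutes_inverses[OF \<pi>])
  have j: "j \<in> {1..n}"
    using k permutes_in_image[OF \<pi>, of j] permutes_in_image[OF \<sigma>, of k] \<pi>j by simp
  have "j \<noteq> k"
    using neq \<pi>j by auto
  moreover have "\<not> j < k"
    using agree[of j] \<pi>j injD[OF permutes_inj[OF \<sigma>], of j k] by auto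
  ultimately have "k < j" by simp
  have fle: "?f k \<le> ?f j"
    using le by (simp add: \<pi>j[symmetric] label_height_perm[OF \<pi>])
  obtain t where t: "k \<le> t" "t < j" "?f t \<le> ?f j" "?f j \<le> ?f t + (int a - 1)"
  proof (cases "?f k = ?f j")
    \<comment> \<open>Vertices of equal height are joined by a tight edge of weight \<open>0\<close>.\<close>
    case True
    then show ?thesis
      using that[of k] \<open>k < j\<close> a by simp
  next
    case False
    with fle have "?f k < ?f j" by simp
    moreover have "?f (Suc i) \<le> ?f i + (int a - 1)" if "k \<le> i" "i < j" for i
      using up_step_height_facts(3)[OF a p] that k j by simp
    ultimately show ?thesis
      using crossing[OF \<open>k < j\<close>, of ?f "int a - 1"] that by (metis less_imp_le)
  qed
  have tn: "t \<in> {1..n}"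
    using t k j by simp
  have "encoded_wdigraph a n (\<pi>, p) (\<pi> t) (\<pi> j) = Some (?f j - ?f t)"
    using t tn j a \<pi> by (simp add: encoded_wdigraph_perm forward_weight_def)
  then have "?f j - ?f t \<le> label_height a \<sigma> q (\<pi> j) - label_height a \<sigma> q (\<pi> t)
      - of_bool (inv \<sigma> (\<pi> j) < inv \<sigma> (\<pi> t))"
    unfolding eq by (rule encoded_edge_le[OF a \<sigma>])
  moreover have "label_height a \<sigma> q (\<pi> j) = ?f j" "label_height a \<sigma> q (\<pi> t) = ?f t"
    using heights[of "\<pi> j"] heights[of "\<pi> t"] j tn permutes_in_image[OF \<pi>]
    by (simp_all add: label_height_perm[OF \<pi>])
  moreover have "inv \<sigma> (\<pi> j) < inv \<sigma> (\<pi> t)"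
  proof -
    define s where "s = inv \<sigma> (\<pi> t)"
    have \<sigma>s: "\<sigma> s = \<pi> t"
      by (simp add: s_def permutes_inverses[OF \<sigma>])
    have "\<not> s < k"
      using agree[of s] \<sigma>s injD[OF permutes_inj[OF \<pi>], of s t] t by auto
    moreover have "s \<noteq> k"
      using \<sigma>s \<pi>j injD[OF permutes_inj[OF \<pi>], of t j] t by auto
    ultimately show ?thesis
      by (simp add: \<pi>j permutes_inverses[OF \<sigma>] flip: s_def)
  qed
  ultimately show False by simp
qed

lemma encoded_wdigraph_inject:
  assumes a: "a \<ge> 1" and \<pi>: "\<pi> permutes {1..n}" and p: "catalan_path a n p"
    and \<sigma>: "\<sigma> permutes {1..n}" and q: "catalan_path a n q"
    and eq: "encoded_wdigraph a n (\<pi>, p) = encoded_wdigraph a n (\<sigma>, q)"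
  shows "\<pi> = \<sigma>" "p = q"
proof -
  have le: "label_height a \<alpha> r v \<le> label_height a \<beta> s v"
    if "\<alpha> permutes {1..n}" "catalan_path a n r" "\<beta> permutes {1..n}" "catalan_path a n s"
      "encoded_wdigraph a n (\<alpha>, r) = encoded_wdigraph a n (\<beta>, s)" "v \<in> {1..n}" for \<alpha> \<beta> r s v
    using encoded_height_le[OF a that(1-5), of "inv \<alpha> v"] that(6)
      permutes_in_image[OF permutes_inv[OF that(1)], of v]
    by (simp add: permutes_inverses[OF that(1)] label_height_def[of a \<alpha>])
  have heights: "label_height a \<pi> p v = label_height a \<sigma> q v" if "v \<in> {1..n}" for v
    using le[OF \<pi> p \<sigma> q eq that] le[OF \<sigma> q \<pi> p eq[symmetric] that] by simp
  have agree: "\<pi> k = \<sigma> k" for k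
  proof (induction k rule: less_induct)
    case (less k)
    show ?case
    proof (cases "k \<in> {1..n}")
      case True
      have "\<pi> k \<in> {1..n}" "\<sigma> k \<in> {1..n}"
        using True permutes_in_image[OF \<pi>] permutes_in_image[OF \<sigma>] by simp_all
      note h = heights[OF this(1)] heights[OF this(2)]
      show ?thesis
      proof (cases "label_height a \<pi> p (\<pi> k) \<le> label_height a \<pi> p (\<sigma> k)")
        case le: True
        show ?thesis
          using encoded_perm_step[OF a \<pi> p \<sigma> eq heights True less le] .
      next
        case False
        then have "label_height a \<sigma> q (\<sigma> k) \<le> label_height a \<sigma> q (\<pi> k)"
          using h by simp
        then show ?thesis
          using encoded_perm_step[OF a \<sigma> q \<pi> eq[symmetric] heights[symmetric] True less[symmetric]]
          by simp
      qed
    next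
      case False
      then show ?thesis
        using \<pi> \<sigma> by (metis permutes_not_in)
    qed
  qed
  then show "\<pi> = \<sigma>" by blast
  have pq: "count_list p Up = n" "count_list q Up = n" "ends_on_axis a 0 p" "ends_on_axis a 0 q"
    using p q a by (simp_all add: catalan_path_iff)
  have "up_heights a 0 p = up_heights a 0 q"
  proof (rule nth_equalityI)
    fix i
    assume "i < length (up_heights a 0 p)"
    then have "Suc i \<in> {1..n}"
      by (simp add: length_up_heights pq)
    then have "up_step_height a p (Suc i) = up_step_height a q (Suc i)"
      using heights[of "\<pi> (Suc i)"] permutes_in_image[OF \<pi>, of "Suc i"]
        label_height_perm[OF \<pi>, of a p "Suc i"] label_height_perm[OF \<sigma>, of a q "Suc i"]
      by (simp only: agree)
    then show "up_heights a 0 p ! i = up_heights a 0 q ! i"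
      using \<open>Suc i \<in> {1..n}\<close> pq by (simp add: up_step_height_eq)
  qed (simp add: length_up_heights pq)
  then show "p = q"
    using pq by (intro up_heights_inject)
qed

section \<open>Heights as longest paths\<close>

fun path_weight :: "wdigraph \<Rightarrow> nat list \<Rightarrow> int" where
  "path_weight w (u # v # vs) = the (w u v) + path_weight w (v # vs)"
| "path_weight w vs = 0"

lemma path_weight_append:
  "path_weight w (xs @ v # ys) = path_weight w (xs @ [v]) + path_weight w (v # ys)"
  by (induction xs rule: induct_list012) auto

lemma path_weight_eq_sum:
  "path_weight w vs = (\<Sum>k<length vs - 1. the (w (vs ! k) (vs ! Suc k)))"
proof (induction w vs rule: path_weight.induct)
  case (1 w u v vs)
  then show ?case
    by (simp add: sum.lessThan_Suc_shift del: sum.lessThan_Suc)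
qed auto

lemma closed_nth:
  assumes "k < length (v # vs)"
  shows "((v # vs) @ [v]) ! k = (v # vs) ! k" "((v # vs) @ [v]) ! Suc k = cycle_next (v # vs) k"
proof -
  show "((v # vs) @ [v]) ! k = (v # vs) ! k"
    using assms by (simp only: nth_append if_True)
  show "((v # vs) @ [v]) ! Suc k = cycle_next (v # vs) k"
  proof (cases "k = length vs")
    case False
    then have "Suc k < length (v # vs)"
      using assms by simp
    then show ?thesis
      by (simp only: cycle_next_def nth_append if_True mod_less)
  qed (simp add: cycle_next_def)
qed

lemma closed_path_weight: "path_weight w ((v # vs) @ [v]) = cycle_weight w (v # vs)"
  unfolding path_weight_eq_sum cycle_weight_def
proof (rule sum.cong)
  fix k
  assume "k \<in> {..<length (v # vs)}"
  then have k: "k < length (v # vs)"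
    by (simp only: lessThan_iff)
  show "the (w (((v # vs) @ [v]) ! k) (((v # vs) @ [v]) ! Suc k)) =
      the (w ((v # vs) ! k) (cycle_next (v # vs) k))"
    by (simp only: closed_nth[OF k])
qed simp

lemma closed_path_cycle:
  assumes "distinct (v # vs)" "successively (\<lambda>x y. w x y \<noteq> None) ((v # vs) @ [v])"
  shows "directed_cycle w (v # vs)"
  unfolding directed_cycle_def
proof (intro conjI allI impI)
  fix k
  assume k: "k < length (v # vs)"
  have "w (((v # vs) @ [v]) ! k) (((v # vs) @ [v]) ! Suc k) \<noteq> None"
    using successively_nth[OF assms(2), of k] k by simp
  then show "w ((v # vs) ! k) (cycle_next (v # vs) k) \<noteq> None"
    by (simp only: closed_nth[OF k] not_False_eq_True)
qed (use assms in auto)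

text \<open>
  The potential is the greatest weight of a simple path ending in \<open>v\<close>. Extending an optimal path
  to \<open>u\<close> by an edge \<open>u \<rightarrow> v\<close> gives a simple path, or a path that closes a cycle; removing that
  cycle does not lower the weight. The last edge of an optimal path is tight.
\<close>

lemma potential_exists:
  assumes fin: "finite V"
    and edges: "\<And>u v x. w u v = Some x \<Longrightarrow> u \<in> V \<and> v \<in> V"
    and cycles: "\<And>vs. directed_cycle w vs \<Longrightarrow> cycle_weight w vs \<le> 0"
  obtains h where "\<And>v. v \<in> V \<Longrightarrow> 0 \<le> h v"
    and "\<And>u v x. w u v = Some x \<Longrightarrow> h u + x \<le> h v"
    and "\<And>v. v \<in> V \<Longrightarrow> 0 < h v \<Longrightarrow> \<exists>u. w u v = Some (h v - h u)"
proof -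
  define P where "P v = {vs. distinct vs \<and> set vs \<subseteq> V \<and> successively (\<lambda>x y. w x y \<noteq> None) vs
    \<and> vs \<noteq> [] \<and> last vs = v}" for v
  define h where "h v = Max (path_weight w ` P v)" for v
  have "P v \<subseteq> {vs. set vs \<subseteq> V \<and> distinct vs}" for v
    by (auto simp: P_def)
  then have finP: "finite (P v)" for v
    using finite_subset_distinct[OF fin] finite_subset by blast
  have triv: "[v] \<in> P v" if "v \<in> V" for v
    using that by (simp add: P_def)
  have ge: "path_weight w vs \<le> h v" if "vs \<in> P v" for v vs
    unfolding h_def using finP that by (intro Max_ge) auto
  have attained: "\<exists>vs\<in>P v. path_weight w vs = h v" if "v \<in> V" for v
  proof -
    have "h v \<in> path_weight w ` P v"
      unfolding h_def using finP triv[OF that] by (intro Max_in) auto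
    then show ?thesis by force
  qed
  have snoc: "path_weight w (r @ [u, v]) = path_weight w (r @ [u]) + x" if "w u v = Some x" for r u v x
    using path_weight_append[of w r u "[v]"] that by simp
  have feasible: "h u + x \<le> h v" if x: "w u v = Some x" for u v x
  proof -
    obtain vs where vs: "vs \<in> P u" "path_weight w vs = h u"
      using attained edges x by blast
    then have "vs \<noteq> []" "last vs = u"
      by (auto simp: P_def)
    then obtain r where r: "vs = r @ [u]"
      by (metis append_butlast_last_id)
    have pw: "path_weight w (vs @ [v]) = h u + x"
      using snoc[OF x] vs(2) r by simp
    have walk: "successively (\<lambda>x y. w x y \<noteq> None) (vs @ [v])"
      using vs(1) x by (auto simp: P_def successively_append_iff)
    show ?thesis
    proof (cases "v \<in> set vs")
      case False
      then have "vs @ [v] \<in> P v"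
        using vs(1) walk edges[OF x] by (auto simp: P_def)
      then show ?thesis
        using ge pw by fastforce
    next
      case True
      then obtain vs1 vs2 where split: "vs = vs1 @ v # vs2"
        by (auto dest: split_list)
      have "vs1 @ [v] \<in> P v"
        using vs(1) by (auto simp: P_def split successively_append_iff)
      moreover have "directed_cycle w (v # vs2)"
        using walk vs(1) by (intro closed_path_cycle) (auto simp: P_def split successively_append_iff)
      then have "path_weight w (v # vs2 @ [v]) \<le> 0"
        using cycles closed_path_weight[of w v vs2] by simp
      moreover have "path_weight w (vs @ [v]) =
          path_weight w (vs1 @ [v]) + path_weight w (v # vs2 @ [v])"
        using path_weight_append[of w vs1 v "vs2 @ [v]"] by (simp add: split)
      ultimately show ?thesis
        using ge pw by fastforce
    qed
  qed
  have nonneg: "0 \<le> h v" if "v \<in> V" for v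
    using ge[OF triv[OF that]] by simp
  have tight: "\<exists>u. w u v = Some (h v - h u)" if v: "v \<in> V" "0 < h v" for v
  proof -
    obtain vs where vs: "vs \<in> P v" "path_weight w vs = h v"
      using attained[OF v(1)] by blast
    then have "vs \<noteq> []" "last vs = v"
      by (auto simp: P_def)
    then obtain q where q: "vs = q @ [v]"
      by (metis append_butlast_last_id)
    then have "q \<noteq> []"
      using vs(2) v(2) by auto
    then obtain r u where r: "q = r @ [u]"
      by (metis append_butlast_last_id)
    obtain x where x: "w u v = Some x"
      using vs(1) by (auto simp: P_def q r successively_append_iff)
    have "q \<in> P u"
      using vs(1) by (auto simp: P_def q r successively_append_iff)
    then have "path_weight w q \<le> h u"
      by (rule ge)
    then have "h v \<le> h u + x"
      using snoc[OF x, of r] vs(2) by (simp add: q r)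
    then show ?thesis
      using feasible[OF x] x by (intro exI[of _ u]) simp
  qed
  show ?thesis
    using that[of h] nonneg feasible tight by blast
qed

section \<open>Surjectivity: listing the vertices\<close>

text \<open>
  \<open>R\<close> stands for the tight edges, and \<open>\<psi>\<close> witnesses that they form no cycle. List first a highest
  vertex \<open>z\<close> among the \<open>R\<close>-minimal ones. A vertex that is minimal once \<open>z\<close> is removed was minimal
  before, and then it is not higher than \<open>z\<close>, or it is an \<open>R\<close>-successor of \<open>z\<close>, and then it is
  higher by at most \<open>a - 1\<close>.
\<close>

lemma greedy_listing:
  fixes h \<psi> :: "nat \<Rightarrow> int"
  assumes "finite S"
    and mono: "\<And>u v. R u v \<Longrightarrow> \<psi> u < \<psi> v"
    and near: "\<And>u v. R u v \<Longrightarrow> h v \<le> h u + (int a - 1)"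
    and a: "a \<ge> 1"
    and "\<And>v. v \<in> S \<Longrightarrow> 0 \<le> h v"
    and "\<And>m. m \<in> S \<Longrightarrow> \<forall>u\<in>S. \<not> R u m \<Longrightarrow> h m \<le> c"
  shows "\<exists>xs. distinct xs \<and> set xs = S \<and> sorted_wrt (\<lambda>u v. \<not> R v u) xs \<and> admissible a c (map h xs)"
  using assms(1,5,6)
proof (induction "card S" arbitrary: S c)
  case 0
  then show ?case
    by (intro exI[of _ "[]"]) simp
next
  case (Suc N)
  define M where "M = {m \<in> S. \<forall>u\<in>S. \<not> R u m}"
  have "S \<noteq> {}"
    using Suc.hyps(2) by auto
  then have "arg_min_on \<psi> S \<in> S" "\<not> (\<exists>u\<in>S. \<psi> u < \<psi> (arg_min_on \<psi> S))"
    using arg_min_if_finite[OF Suc.prems(1), of \<psi>] by auto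
  then have "arg_min_on \<psi> S \<in> M"
    using mono by (auto simp: M_def)
  then have "finite (h ` M)" "h ` M \<noteq> {}"
    using Suc.prems(1) by (auto simp: M_def)
  then obtain z where z: "z \<in> M" "h z = Max (h ` M)"
    using Max_in by (metis imageE)
  then have highest: "h m \<le> h z" if "m \<in> M" for m
    using \<open>finite (h ` M)\<close> that by simp
  have zS: "z \<in> S" "\<forall>u\<in>S. \<not> R u z"
    using z(1) by (auto simp: M_def)
  have "h m \<le> h z + (int a - 1)" if "m \<in> S - {z}" "\<forall>u\<in>S - {z}. \<not> R u m" for m
  proof (cases "R z m")
    case True
    then show ?thesis by (rule near)
  next
    case False
    then have "m \<in> M"
      using that by (auto simp: M_def)
    then show ?thesis
      using highest[of m] a by simp
  qed
  then obtain xs where xs: "distinct xs" "set xs = S - {z}" "sorted_wrt (\<lambda>u v. \<not> R v u) xs"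
    "admissible a (h z + (int a - 1)) (map h xs)"
    using Suc.hyps(1)[of "S - {z}" "h z + (int a - 1)"] Suc.hyps(2)[symmetric] Suc.prems(1,2) zS
    by auto
  then show ?case
    using zS Suc.prems by (intro exI[of _ "z # xs"]) auto
qed

lemma valid_wdigraph_cases:
  assumes "valid_wdigraph a n w" "u \<in> {1..n}" "v \<in> {1..n}" "u \<noteq> v"
  obtains "w u v = None" "w v u = Some (int a - 1)"
    | x where "1 - int a \<le> x" "x \<le> int a - 2" "w u v = Some x" "w v u = Some (- x - 1)"
    | "w u v = Some (int a - 1)" "w v u = None"
proof -
  have pair: "(w i j = None \<and> w j i = Some (int a - 1)) \<or>
      (\<exists>x. 1 - int a \<le> x \<and> x \<le> int a - 2 \<and> w i j = Some x \<and> w j i = Some (- x - 1)) \<or>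
      (w i j = Some (int a - 1) \<and> w j i = None)"
    if "i \<in> {1..n}" "j \<in> {1..n}" "i < j" for i j
    using conjunct2[OF assms(1)[unfolded valid_wdigraph_def]] that by (simp only:)
  show ?thesis
  proof (cases "u < v")
    case True
    from pair[OF assms(2,3) this] show ?thesis
      by (elim disjE exE conjE) (rule that; assumption)+
  next
    case False
    then have "v < u"
      using assms(4) by simp
    from pair[OF assms(3,2) this] show ?thesis
    proof (elim disjE exE conjE)
      fix x
      assume "1 - int a \<le> x" "x \<le> int a - 2" "w v u = Some x" "w u v = Some (- x - 1)"
      then show ?thesis
        using that(2)[of "- x - 1"] by simp
    qed (rule that; assumption)+
  qed
qed

text \<open>
  Two opposite edges of weights \<open>x\<close> and \<open>- x - 1\<close> confine \<open>h v - h u\<close> to \<open>{x, x + 1}\<close>, where the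
  value \<open>x + 1\<close> means that \<open>v \<rightarrow> u\<close> is tight. A single edge of weight \<open>a - 1\<close> only says that
  its end is at least \<open>a - 1\<close> higher than its start, which is what truncation retains of such a
  height difference.
\<close>

lemma valid_weights_from_heights:
  assumes a: "a \<ge> 1" and valid: "valid_wdigraph a n w"
    and uv: "u \<in> {1..n}" "v \<in> {1..n}" "u \<noteq> v"
    and feasible: "\<And>u v x. w u v = Some x \<Longrightarrow> h u + x \<le> h v"
    and loose: "w v u \<noteq> Some (h u - h v)"
  shows "w u v = forward_weight a (h v - h u)" "w v u = forward_weight a (h u - h v - 1)"
proof -
  have "w u v = forward_weight a (h v - h u) \<and> w v u = forward_weight a (h u - h v - 1)"
    using valid uv
  proof (cases rule: valid_wdigraph_cases)
    case 1
    then show ?thesis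
      using feasible[of v u] loose a by (auto simp: forward_weight_def)
  next
    case (2 x)
    have "h u + x \<le> h v" "h v - x - 1 \<le> h u" "- x - 1 \<noteq> h u - h v"
      using feasible[of u v] feasible[of v u] 2 loose by auto
    then have "x = h v - h u" by linarith
    then show ?thesis
      using 2 by (auto simp: forward_weight_def)
  next
    case 3
    then show ?thesis
      using feasible[of u v] a by (auto simp: forward_weight_def)
  qed
  then show "w u v = forward_weight a (h v - h u)" "w v u = forward_weight a (h u - h v - 1)"
    by simp_all
qed

lemma encoded_wdigraph_surj:
  assumes a: "a \<ge> 1" and valid: "valid_wdigraph a n w" and acyc: "m_acyclic w"
  shows "\<exists>\<pi> p. \<pi> permutes {1..n} \<and> catalan_path a n p \<and> encoded_wdigraph a n (\<pi>, p) = w"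
proof -
  have edge: "u \<in> {1..n}" "v \<in> {1..n}" "u \<noteq> v" if "w u v = Some x" for u v x
    using valid that by (auto simp: valid_wdigraph_def)
  have weight_le: "x \<le> int a - 1" if "w u v = Some x" for u v x
    using valid edge[OF that] by (cases rule: valid_wdigraph_cases) (use that in auto)
  have negative: "cycle_weight w vs < 0" if "directed_cycle w vs" for vs
    using acyc that by (auto simp: m_acyclic_def not_le)
  obtain h where h: "\<And>v. v \<in> {1..n} \<Longrightarrow> 0 \<le> h v"
      "\<And>u v x. w u v = Some x \<Longrightarrow> h u + x \<le> h v"
      "\<And>v. v \<in> {1..n} \<Longrightarrow> 0 < h v \<Longrightarrow> \<exists>u. w u v = Some (h v - h u)"
    by (rule potential_exists[of "{1..n}" w]) (use edge negative in \<open>auto intro: less_imp_le\<close>)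
  \<comment> \<open>Tight edges close no cycle. To have a function increasing along them, perturb the weights by
      counting edges: a cycle has weight at most \<open>- 1\<close> and at most \<open>n\<close> edges, so the perturbed
      cycles are still not positive.\<close>
  define w' where "w' u v = map_option (\<lambda>x. (int n + 1) * x + 1) (w u v)" for u v
  have cycles': "cycle_weight w' vs \<le> 0" if cyc': "directed_cycle w' vs" for vs
  proof -
    have cyc: "directed_cycle w vs"
      using cyc' by (simp add: directed_cycle_def w'_def)
    have "set vs \<subseteq> {1..n}"
    proof
      fix v
      assume "v \<in> set vs"
      then obtain k where "k < length vs" "v = vs ! k"
        by (auto simp: in_set_conv_nth)
      then show "v \<in> {1..n}"
        using cyc edge(1) by (force simp: directed_cycle_def)
    qed
    then have "length vs \<le> n"
      using card_mono[of "{1..n}" "set vs"] cyc by (simp add: distinct_card directed_cycle_def)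
    have "cycle_weight w' vs =
        (\<Sum>k<length vs. (int n + 1) * the (w (vs ! k) (cycle_next vs k)) + 1)"
      unfolding cycle_weight_def
      by (rule sum.cong) (use cyc in \<open>auto simp: directed_cycle_def w'_def\<close>)
    also have "\<dots> = (int n + 1) * cycle_weight w vs + int (length vs)"
      by (simp add: cycle_weight_def sum.distrib sum_distrib_left)
    also have "\<dots> \<le> (int n + 1) * (- 1) + int n"
      using negative[OF cyc] \<open>length vs \<le> n\<close> by (intro add_mono mult_left_mono) auto
    finally show ?thesis by simp
  qed
  obtain \<phi> where \<phi>: "\<And>u v x. w' u v = Some x \<Longrightarrow> \<phi> u + x \<le> \<phi> v"
    by (rule potential_exists[of "{1..n}" w']) (use edge cycles' in \<open>auto simp: w'_def\<close>)
  define R where "R u v \<longleftrightarrow> w u v = Some (h v - h u)" for u v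
  have "\<exists>xs. distinct xs \<and> set xs = {1..n} \<and> sorted_wrt (\<lambda>u v. \<not> R v u) xs
      \<and> admissible a 0 (map h xs)"
  proof (rule greedy_listing)
    show "\<phi> u - (int n + 1) * h u < \<phi> v - (int n + 1) * h v" if "R u v" for u v
    proof -
      have "w' u v = Some ((int n + 1) * (h v - h u) + 1)"
        using that by (simp add: R_def w'_def)
      from \<phi>[OF this] show ?thesis
        by (simp add: algebra_simps)
    qed
    show "h v \<le> h u + (int a - 1)" if "R u v" for u v
      using weight_le[of u v] that by (simp add: R_def)
    show "h m \<le> 0" if "m \<in> {1..n}" "\<forall>u\<in>{1..n}. \<not> R u m" for m
      using h(3)[OF that(1)] that(2) edge(1) by (force simp: R_def)
  qed (use a h(1) in auto)
  then obtain xs where xs: "distinct xs" "set xs = {1..n}" "sorted_wrt (\<lambda>u v. \<not> R v u) xs"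
    "admissible a 0 (map h xs)"
    by blast
  have len: "length xs = n"
    using xs(1,2) distinct_card by fastforce
  obtain p where p: "ends_on_axis a 0 p" "up_heights a 0 p = map h xs"
    using path_with_up_heights[OF a _ xs(4)] by auto
  have up: "count_list p Up = n"
    using p(2) length_up_heights[of a 0 p] len by simp
  define \<pi> where "\<pi> i = (if i \<in> {1..n} then xs ! (i - 1) else i)" for i
  have "bij_betw (\<lambda>i. xs ! (i - 1)) {1..n} {1..n}"
  proof -
    have "bij_betw (\<lambda>i. i - 1) {1..n} {..<n}"
      by (rule bij_betwI[where g = Suc]) auto
    moreover have "bij_betw ((!) xs) {..<n} {1..n}"
      using bij_betw_nth[OF xs(1)] len xs(2) by simp
    ultimately show ?thesis
      using bij_betw_trans by (fastforce simp: o_def)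
  qed
  moreover have "bij_betw \<pi> {1..n} {1..n} \<longleftrightarrow> bij_betw (\<lambda>i. xs ! (i - 1)) {1..n} {1..n}"
    by (rule bij_betw_cong) (simp add: \<pi>_def)
  ultimately have "bij_betw \<pi> {1..n} {1..n}"
    by simp
  then have \<pi>: "\<pi> permutes {1..n}"
    by (rule bij_imp_permutes) (auto simp: \<pi>_def)
  have height: "up_step_height a p i = h (\<pi> i)" if "i \<in> {1..n}" for i
    using that up len p(2) by (auto simp: up_step_height_eq \<pi>_def)
  have pair: "encoded_wdigraph a n (\<pi>, p) (\<pi> i) (\<pi> j) = w (\<pi> i) (\<pi> j) \<and>
      encoded_wdigraph a n (\<pi>, p) (\<pi> j) (\<pi> i) = w (\<pi> j) (\<pi> i)"
    if ij: "i \<in> {1..n}" "j \<in> {1..n}" "i < j" for i j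
  proof -
    have V: "\<pi> i \<in> {1..n}" "\<pi> j \<in> {1..n}" "\<pi> i \<noteq> \<pi> j"
      using ij permutes_in_image[OF \<pi>] injD[OF permutes_inj[OF \<pi>], of i j] by auto
    have "\<not> R (\<pi> j) (\<pi> i)"
      using sorted_wrt_nth_less[OF xs(3), of "i - 1" "j - 1"] ij len by (auto simp: \<pi>_def)
    then have "w (\<pi> j) (\<pi> i) \<noteq> Some (h (\<pi> i) - h (\<pi> j))"
      by (simp add: R_def)
    from valid_weights_from_heights[OF a valid V h(2) this] show ?thesis
      using ij by (simp add: encoded_wdigraph_perm[OF a \<pi>] height)
  qed
  have "encoded_wdigraph a n (\<pi>, p) u v = w u v" for u v
  proof (cases "u \<in> {1..n} \<and> v \<in> {1..n} \<and> u \<noteq> v")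
    case True
    define i j where "i = inv \<pi> u" and "j = inv \<pi> v"
    have ij: "\<pi> i = u" "\<pi> j = v"
      by (simp_all add: i_def j_def permutes_inverses[OF \<pi>])
    then have "i \<in> {1..n}" "j \<in> {1..n}" "i \<noteq> j"
      using True permutes_in_image[OF \<pi>] by auto
    then show ?thesis
      using pair[of i j] pair[of j i] ij by (cases "i < j") auto
  next
    case False
    then show ?thesis
      using edge[of u v] encoded_edge_vertices[of a n \<pi> p u v]
      by (cases "w u v"; cases "encoded_wdigraph a n (\<pi>, p) u v") auto
  qed
  then have "encoded_wdigraph a n (\<pi>, p) = w"
    by blast
  moreover have "catalan_path a n p"
    using a p(1) up by (simp add: catalan_path_iff)
  ultimately show ?thesis
    using \<pi> by blast
qed

theorem theorem8p7:
  fixes a n :: nat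
  assumes "a \<ge> 1" and "n \<ge> 1"
  shows "bij_betw (encoded_wdigraph a n)
           ({\<pi>. \<pi> permutes {1..n}} \<times> {p. catalan_path a n p})
           {w. valid_wdigraph a n w \<and> m_acyclic w}"
  unfolding bij_betw_def
proof
  show "inj_on (encoded_wdigraph a n) ({\<pi>. \<pi> permutes {1..n}} \<times> {p. catalan_path a n p})"
    using encoded_wdigraph_inject[OF assms(1)] by (auto simp: inj_on_def)
next
  show "encoded_wdigraph a n ` ({\<pi>. \<pi> permutes {1..n}} \<times> {p. catalan_path a n p}) =
      {w. valid_wdigraph a n w \<and> m_acyclic w}"
  proof (intro equalityI subsetI)
    fix w
    assume "w \<in> encoded_wdigraph a n ` ({\<pi>. \<pi> permutes {1..n}} \<times> {p. catalan_path a n p})"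
    then show "w \<in> {w. valid_wdigraph a n w \<and> m_acyclic w}"
      using valid_encoded_wdigraph[OF assms(1)] m_acyclic_encoded_wdigraph[OF assms(1)] by auto
  next
    fix w
    assume "w \<in> {w. valid_wdigraph a n w \<and> m_acyclic w}"
    then show "w \<in> encoded_wdigraph a n ` ({\<pi>. \<pi> permutes {1..n}} \<times> {p. catalan_path a n p})"
      using encoded_wdigraph_surj[OF assms(1), of n w] by force
  qed
qed

end
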